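(* There exist a Bertrand numeration system $U$ and a $U$-automatic infinite word $\mathbf{x}$ over a finite alphabet whose factor complexity function $p_{\mathbf{x}}$ is superlinear, i.e., $p_{\mathbf{x}}(n)/n\to\infty$ as $n\to\infty$.
   Context: Numeration systems. A (positional) numeration system is an increasing sequence $U=(U_n)_{n\ge 0}$ of integers with $U_0=1$ and $C_U:=\sup_{n\ge 0}\lceil U_{n+1}/U_n\rceil<+\infty$. Put $A_U=\{0,\ldots,C_U-1\}$. The greedy representation of a positive integer $n$ is the word $\mathrm{rep}_U(n)=w_{\ell-1}\cdots w_0$ over $A_U$ with $\sum_{i=0}^{\ell-1}w_iU_i=n$, $w_{\ell-1}\neq 0$ and $\sum_{i=0}^{j-1}w_iU_i<U_j$ for all $j\in\{1,\ldots,\ell\}$; $\mathrm{rep}_U(0)=\varepsilon$ is the empty word. Bertrand numeration systems. $U$ is a Bertrand numeration system if, for all nonempty words $w\in A_U^*$, $w\in\mathrm{rep}_U(\mathbb{N})$ if and only if $w0\in\mathrm{rep}_U(\mathbb{N})$. Automatic sequences. An infinite word $\mathbf{x}=(x_n)_{n\ge0}$ over a finite alphabet $B$ is $U$-automatic if there is a complete deterministic finite automaton with output $(Q,q_0,A_U,\delta,\tau)$, with transition function $\delta\colon Q\times A_U\to Q$ (extended to words, read from left to right, most significant digit first) and output function $\tau\colon Q\to B$, such that $\delta(q_0,0)=q_0$ and $x_n=\tau(\delta(q_0,\mathrm{rep}_U(n)))$ for all $n\ge0$. Factor complexity. $p_{\mathbf{x}}(n)$ is the number of distinct factors (blocks of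 consecutive letters) of length $n$ occurring in $\mathbf{x}$. *)

theory Defs
  imports Complex_Main
begin

text \<open>
  As \<open>U 0 = 1\<close> and \<open>U\<close> is strictly increasing, all its terms are positive integers; they are
  taken in \<^typ>\<open>nat\<close>.
\<close>

definition numeration_system :: "(nat \<Rightarrow> nat) \<Rightarrow> bool" where
  "numeration_system U \<longleftrightarrow>
     strict_mono U \<and> U 0 = 1 \<and> bdd_above (range (\<lambda>n. \<lceil>real (U (Suc n)) / real (U n)\<rceil>))"

definition digit_bound :: "(nat \<Rightarrow> nat) \<Rightarrow> nat" where
  "digit_bound U = nat (SUP n. \<lceil>real (U (Suc n)) / real (U n)\<rceil>)"

definition digits :: "(nat \<Rightarrow> nat) \<Rightarrow> nat set" where
  "digits U = {0..<digit_bound U}"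

text \<open>
  Words are lists with the most significant digit first, so the digit of weight \<open>U i\<close> in
  \<open>w\<close> is \<open>rev w ! i\<close>.
\<close>

definition is_greedy_rep :: "(nat \<Rightarrow> nat) \<Rightarrow> nat \<Rightarrow> nat list \<Rightarrow> bool" where
  "is_greedy_rep U n w \<longleftrightarrow>
     w \<in> lists (digits U) \<and>
     (\<Sum>i<length w. rev w ! i * U i) = n \<and>
     w \<noteq> [] \<and> hd w \<noteq> 0 \<and>
     (\<forall>j\<in>{1..length w}. (\<Sum>i<j. rev w ! i * U i) < U j)"

definition rep :: "(nat \<Rightarrow> nat) \<Rightarrow> nat \<Rightarrow> nat list" where
  "rep U n = (if n = 0 then [] else (THE w. is_greedy_rep U n w))"

definition bertrand :: "(nat \<Rightarrow> nat) \<Rightarrow> bool" where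
  "bertrand U \<longleftrightarrow>
     numeration_system U \<and>
     (\<forall>w\<in>lists (digits U). w \<noteq> [] \<longrightarrow> (w \<in> range (rep U) \<longleftrightarrow> w @ [0] \<in> range (rep U)))"

record ('q, 'b) dfao =
  states :: "'q set"
  init :: 'q
  transition :: "'q \<Rightarrow> nat \<Rightarrow> 'q"
  label :: "'q \<Rightarrow> 'b"

definition complete_dfao :: "nat set \<Rightarrow> 'b set \<Rightarrow> ('q, 'b) dfao \<Rightarrow> bool" where
  "complete_dfao A B M \<longleftrightarrow>
     finite (states M) \<and> init M \<in> states M \<and>
     (\<forall>q\<in>states M. \<forall>a\<in>A. transition M q a \<in> states M) \<and>
     (\<forall>q\<in>states M. label M q \<in> B)"

text \<open>
  States are taken in \<^typ>\<open>nat\<close> without loss of generality, every finite set of states being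
  in bijection with a set of natural numbers.
\<close>

definition automatic :: "(nat \<Rightarrow> nat) \<Rightarrow> 'b set \<Rightarrow> (nat \<Rightarrow> 'b) \<Rightarrow> bool" where
  "automatic U B x \<longleftrightarrow>
     (\<exists>M :: (nat, 'b) dfao.
        complete_dfao (digits U) B M \<and>
        transition M (init M) 0 = init M \<and>
        (\<forall>n. x n = label M (foldl (transition M) (init M) (rep U n))))"

definition factors :: "(nat \<Rightarrow> 'b) \<Rightarrow> nat \<Rightarrow> 'b list set" where
  "factors x n = range (\<lambda>i. map x [i..<i + n])"

definition factor_complexity :: "(nat \<Rightarrow> 'b) \<Rightarrow> nat \<Rightarrow> nat" where
  "factor_complexity x n = card (factors x n)"

end

theory Submission
  imports Defs "HOL-Real_Asymp.Real_Asymp"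
begin

text \<open>
  Take \<open>U k = 2 ^ (k + 1) - 1\<close>, the Bertrand system attached to the expansion
  \<open>d\<^sub>2(1) = 2 0 0 0 \<dots>\<close> instead of \<open>d\<^sub>2\<^sup>*(1) = 1 1 1 \<dots>\<close>: because \<open>U (k + 1) = 2 U k + 1\<close>, the
  representations are the words over \<open>{0,1,2}\<close> not starting with \<open>0\<close> in which a digit \<open>2\<close> is
  followed by zeros only. The automaton that remembers whether a \<open>2\<close> has been read produces the
  fixed point of \<open>0 \<mapsto> 001, 1 \<mapsto> 1\<close>. In it, for every \<open>j\<close>, a run of exactly \<open>j\<close> ones ends just
  before position \<open>U j\<close>, and sliding a window of length \<open>n\<close> along the runs with \<open>j > n/2\<close> yields
  quadratically many factors, since such a run can be recovered from the window.
\<close>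

section \<open>The numbers \<open>2 ^ (k + 1) - 1\<close> as a numeration system\<close>

definition mersenne :: "nat \<Rightarrow> nat" where
  "mersenne k = 2 ^ Suc k - 1"

lemma mersenne_0 [simp]: "mersenne 0 = 1"
  by (simp add: mersenne_def)

lemma mersenne_Suc: "mersenne (Suc k) = 2 * mersenne k + 1"
proof -
  have "(1::nat) \<le> 2 ^ k" by simp
  then show ?thesis unfolding mersenne_def power_Suc by linarith
qed

lemma mersenne_pos [simp]: "0 < mersenne k"
  by (cases k) (simp_all add: mersenne_Suc)

lemma mersenne_neq_0 [simp]: "mersenne k \<noteq> 0"
  using mersenne_pos[of k] by linarith

lemma strict_mono_mersenne: "strict_mono mersenne"
  by (rule strict_mono_Suc_iff[THEN iffD2]) (simp add: mersenne_Suc)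

lemma two_mult_less_mersenne: "2 * k < mersenne k"
  by (induction k) (simp_all add: mersenne_Suc)

text \<open>The ratio is \<open>2 + 1 / mersenne k\<close> with second term in
  \<open>(0, 1]\<close>, so the supremum is 3 and the digits are 0, 1, 2.\<close>

lemma ceiling_mersenne_ratio: "\<lceil>real (mersenne (Suc k)) / real (mersenne k)\<rceil> = 3"
proof -
  have "real (mersenne k) \<ge> 1"
    using mersenne_pos[of k] by linarith
  then show ?thesis
    by (simp add: mersenne_Suc ceiling_eq_iff field_simps)
qed

lemma numeration_system_mersenne: "numeration_system mersenne"
  by (simp add: numeration_system_def strict_mono_mersenne ceiling_mersenne_ratio)

lemma digits_mersenne: "digits mersenne = {0..<3}"
  by (simp add: digits_def digit_bound_def ceiling_mersenne_ratio)


section \<open>Greedy representations\<close>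

text \<open>Peeling off the most significant digit makes the reverse-indexed sum in
  \<open>is_greedy_rep\<close> accessible to list induction.\<close>

fun word_value :: "(nat \<Rightarrow> nat) \<Rightarrow> nat list \<Rightarrow> nat" where
  "word_value U [] = 0"
| "word_value U (d # w) = d * U (length w) + word_value U w"

lemma sum_rev_nth_eq_word_value:
  "(\<Sum>i<length w. rev w ! i * U i) = word_value U w"
proof (induction w)
  case (Cons d w)
  have "(\<Sum>i<length w. rev (d # w) ! i * U i) = (\<Sum>i<length w. rev w ! i * U i)"
    by (rule sum.cong) (simp_all add: nth_append)
  with Cons show ?case by (simp add: nth_append)
qed simp

lemma greedy_condition_Cons:
  "(\<forall>j\<in>{1..length (d # w)}. (\<Sum>i<j. rev (d # w) ! i * U i) < U j) \<longleftrightarrow>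
     word_value U (d # w) < U (Suc (length w)) \<and>
     (\<forall>j\<in>{1..length w}. (\<Sum>i<j. rev w ! i * U i) < U j)"
proof -
  have "{1..length (d # w)} = insert (Suc (length w)) {1..length w}"
    by auto
  moreover have "(\<Sum>i<j. rev (d # w) ! i * U i) = (\<Sum>i<j. rev w ! i * U i)" if "j \<le> length w" for j
    using that by (intro sum.cong) (simp_all add: nth_append)
  ultimately show ?thesis
    using sum_rev_nth_eq_word_value[of "d # w" U] by simp
qed

text \<open>Leading zeros are permitted, so that words can be padded to a given length.\<close>

fun admissible :: "nat list \<Rightarrow> bool" where
  "admissible [] \<longleftrightarrow> True"
| "admissible (d # w) \<longleftrightarrow> d \<le> 2 \<and> (d = 2 \<longrightarrow> set w \<subseteq> {0}) \<and> admissible w"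

lemma admissible_append_0 [simp]: "admissible (w @ [0]) \<longleftrightarrow> admissible w"
  by (induction w) auto

lemma admissible_replicate_0 [simp]: "admissible (replicate k 0)"
  by (induction k) auto

lemma admissible_replicate_1_append [simp]: "admissible (replicate k 1 @ w) \<longleftrightarrow> admissible w"
  by (induction k) auto

lemma admissible_dropWhile: "admissible w \<Longrightarrow> admissible (dropWhile P w)"
  by (induction w) auto

lemma admissible_imp_digits: "admissible w \<Longrightarrow> w \<in> lists (digits mersenne)"
  by (induction w) (auto simp: digits_mersenne)

lemma word_value_mersenne_eq_0_iff: "word_value mersenne w = 0 \<longleftrightarrow> set w \<subseteq> {0}"
  by (induction w) auto

lemma word_value_replicate_0: "word_value mersenne (replicate k 0) = 0"
  by (auto simp: word_value_mersenne_eq_0_iff)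

text \<open>For a tail of length \<open>k\<close>, a leading 0 or 1 adds at most
  \<open>mersenne k\<close> to a value below \<open>mersenne k\<close>; a leading 2 gives exactly
  \<open>2 * mersenne k\<close>, one below \<open>mersenne (Suc k)\<close>.\<close>

lemma admissible_word_value_less:
  "admissible w \<Longrightarrow> word_value mersenne w < mersenne (length w)"
proof (induction w)
  case (Cons d w)
  then have "d = 0 \<or> d = 1 \<or> (d = 2 \<and> word_value mersenne w = 0)"
    by (auto simp: word_value_mersenne_eq_0_iff)
  with Cons show ?case by (auto simp: mersenne_Suc)
qed simp

lemma greedy_condition_iff_admissible:
  assumes "w \<in> lists (digits mersenne)"
  shows "(\<forall>j\<in>{1..length w}. (\<Sum>i<j. rev w ! i * mersenne i) < mersenne j) \<longleftrightarrow> admissible w"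
  using assms
proof (induction w)
  case (Cons d w)
  then have d: "d \<le> 2" and
    IH: "(\<forall>j\<in>{1..length w}. (\<Sum>i<j. rev w ! i * mersenne i) < mersenne j) \<longleftrightarrow> admissible w"
    by (auto simp: digits_mersenne)
  have "word_value mersenne (d # w) < mersenne (Suc (length w)) \<and> admissible w
      \<longleftrightarrow> admissible (d # w)"
  proof
    assume *: "word_value mersenne (d # w) < mersenne (Suc (length w)) \<and> admissible w"
    \<comment> \<open>With \<open>d = 2\<close> the bound reads
      \<open>2 * u + v < 2 * u + 1\<close>, so the value \<open>v\<close> of the tail is 0.\<close>
    have "d = 2 \<Longrightarrow> word_value mersenne w = 0"
      using * by (simp add: mersenne_Suc)
    then show "admissible (d # w)"
      using * d by (simp add: word_value_mersenne_eq_0_iff)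
  next
    assume "admissible (d # w)"
    then show "word_value mersenne (d # w) < mersenne (Suc (length w)) \<and> admissible w"
      using admissible_word_value_less[of "d # w"] by simp
  qed
  then show ?case
    unfolding greedy_condition_Cons IH .
qed simp

lemma is_greedy_rep_mersenne_iff:
  "is_greedy_rep mersenne n w \<longleftrightarrow>
     w \<noteq> [] \<and> hd w \<noteq> 0 \<and> admissible w \<and> word_value mersenne w = n"
  unfolding is_greedy_rep_def sum_rev_nth_eq_word_value
  using greedy_condition_iff_admissible[of w] admissible_imp_digits[of w] by blast

text \<open>The tail is worth less than the weight of the leading digit, so that digit is the
  quotient by this weight.\<close>

lemma word_value_mersenne_inj:
  assumes "admissible v" "admissible w" "length v = length w"
    "word_value mersenne v = word_value mersenne w"
  shows "v = w"
  using assms(3,1,2,4)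
proof (induction v w rule: list_induct2)
  case (Cons c v d w)
  let ?u = "mersenne (length w)"
  have less: "word_value mersenne v < ?u" "word_value mersenne w < ?u"
    using Cons admissible_word_value_less[of v] admissible_word_value_less[of w] by auto
  have eq: "c * ?u + word_value mersenne v = d * ?u + word_value mersenne w"
    using Cons by simp
  have "(c * ?u + word_value mersenne v) div ?u = c" "(d * ?u + word_value mersenne w) div ?u = d"
    using less by (simp_all add: div_mult_self3)
  then have "c = d" using eq by simp
  with eq Cons show ?case by simp
qed simp

lemma mersenne_length_le_word_value:
  "w \<noteq> [] \<Longrightarrow> hd w \<noteq> 0 \<Longrightarrow> mersenne (length w - 1) \<le> word_value mersenne w"
  by (cases w) (auto intro: trans_le_add1)

lemma is_greedy_rep_mersenne_unique:
  assumes "is_greedy_rep mersenne n v" "is_greedy_rep mersenne n w"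
  shows "v = w"
proof -
  \<comment> \<open>The nonzero first digit of \<open>v\<close> makes the common value at least
    \<open>mersenne (length v - 1)\<close>, while admissibility of \<open>w\<close> keeps it below
    \<open>mersenne (length w)\<close>.\<close>
  have le: "length v \<le> length w"
    if "is_greedy_rep mersenne n v" "is_greedy_rep mersenne n w" for v w
  proof -
    have "mersenne (length v - 1) < mersenne (length w)"
      using that mersenne_length_le_word_value[of v] admissible_word_value_less[of w]
      by (auto simp: is_greedy_rep_mersenne_iff)
    then show ?thesis
      using strict_mono_less[OF strict_mono_mersenne] by fastforce
  qed
  have "length v = length w"
    using le assms by (meson le_antisym)
  then show ?thesis
    using assms word_value_mersenne_inj by (auto simp: is_greedy_rep_mersenne_iff)
qed

text \<open>The values split by leading digit: 0 and 1 each cover an interval of length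
  \<open>mersenne k\<close>, and 2 only the maximum \<open>2 * mersenne k\<close>.\<close>

lemma ex_admissible_word_value:
  "n < mersenne k \<Longrightarrow> \<exists>w. length w = k \<and> admissible w \<and> word_value mersenne w = n"
proof (induction k arbitrary: n)
  case (Suc k)
  consider "n < mersenne k" | "mersenne k \<le> n" "n < 2 * mersenne k" | "n = 2 * mersenne k"
    using Suc.prems by (fastforce simp: mersenne_Suc)
  then show ?case
  proof cases
    case 1
    then obtain w where "length w = k" "admissible w" "word_value mersenne w = n"
      using Suc.IH by blast
    then show ?thesis by (intro exI[of _ "0 # w"]) simp
  next
    case 2
    then have "n - mersenne k < mersenne k" by linarith
    then obtain w where "length w = k" "admissible w" "word_value mersenne w = n - mersenne k"
      using Suc.IH by blast
    with 2 show ?thesis by (intro exI[of _ "1 # w"]) simp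
  next
    case 3
    then show ?thesis
      by (intro exI[of _ "2 # replicate k 0"]) (auto simp: word_value_replicate_0)
  qed
qed simp

lemma word_value_dropWhile_0: "word_value U (dropWhile (\<lambda>d. d = 0) w) = word_value U w"
  by (induction w) auto

lemma ex_is_greedy_rep_mersenne:
  assumes "0 < n"
  shows "\<exists>w. is_greedy_rep mersenne n w"
proof -
  have "n < mersenne n"
    using two_mult_less_mersenne[of n] by simp
  then obtain w where w: "admissible w" "word_value mersenne w = n"
    using ex_admissible_word_value by blast
  let ?v = "dropWhile (\<lambda>d. d = 0) w"
  have "word_value mersenne ?v = n"
    using w by (simp add: word_value_dropWhile_0)
  moreover from this have "?v \<noteq> []"
    using assms by force
  moreover from this have "hd ?v \<noteq> 0"
    by (rule hd_dropWhile)
  ultimately show ?thesis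
    using w admissible_dropWhile unfolding is_greedy_rep_mersenne_iff by blast
qed

lemma rep_mersenne_eqI:
  assumes "w \<noteq> []" "hd w \<noteq> 0" "admissible w" "word_value mersenne w = n"
  shows "rep mersenne n = w"
proof -
  have "is_greedy_rep mersenne n w"
    using assms by (simp add: is_greedy_rep_mersenne_iff)
  moreover have "n \<noteq> 0"
    using assms mersenne_length_le_word_value[of w] mersenne_pos[of "length w - 1"] by linarith
  ultimately show ?thesis
    unfolding rep_def using is_greedy_rep_mersenne_unique by auto
qed

lemma in_range_rep_mersenne_iff:
  assumes "w \<noteq> []"
  shows "w \<in> range (rep mersenne) \<longleftrightarrow> hd w \<noteq> 0 \<and> admissible w"
proof
  assume "w \<in> range (rep mersenne)"
  then obtain n where n: "w = rep mersenne n" by blast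
  with assms have "n > 0" by (cases n) (auto simp: rep_def)
  then obtain v where "is_greedy_rep mersenne n v"
    using ex_is_greedy_rep_mersenne by blast
  then have "hd v \<noteq> 0" "admissible v" "rep mersenne n = v"
    using rep_mersenne_eqI by (auto simp: is_greedy_rep_mersenne_iff)
  with n show "hd w \<noteq> 0 \<and> admissible w" by simp
next
  assume "hd w \<noteq> 0 \<and> admissible w"
  then show "w \<in> range (rep mersenne)"
    using assms rep_mersenne_eqI by (metis rangeI)
qed

text \<open>On nonempty words, a final 0 affects neither the first digit nor admissibility.\<close>

lemma bertrand_mersenne: "bertrand mersenne"
  by (simp add: bertrand_def numeration_system_mersenne in_range_rep_mersenne_iff)


section \<open>Long runs and factor complexity\<close>

definition two_indicator :: "nat \<Rightarrow> nat" where
  "two_indicator n = (if 2 \<in> set (rep mersenne n) then 1 else 0)"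

lemma automatic_two_indicator: "automatic mersenne {0, 1} two_indicator"
proof -
  \<comment> \<open>State 1 is absorbing and entered on the digit 2; the digit 0 fixes the initial
    state.\<close>
  let ?M = "\<lparr>states = {0, 1}, init = 0, transition = \<lambda>q a. if a = 2 then 1 else q, label = id\<rparr>
    :: (nat, nat) dfao"
  have "foldl (transition ?M) q w = (if 2 \<in> set w then 1 else q)" for q w
    by (induction w arbitrary: q) auto
  then show ?thesis
    unfolding automatic_def
    by (intro exI[of _ ?M]) (simp add: complete_dfao_def two_indicator_def)
qed

text \<open>Each added 1 has weight \<open>mersenne l = mersenne (Suc l) - mersenne l - 1\<close>,
  so the sum telescopes. The additive form avoids truncated subtraction.\<close>

lemma word_value_replicate_1_append:
  "word_value mersenne (replicate k 1 @ w) + mersenne (length w) + k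
     = mersenne (length w + k) + word_value mersenne w"
  by (induction k) (simp_all add: mersenne_Suc add.commute)

lemma two_indicator_mersenne: "two_indicator (mersenne j) = 0"
proof -
  have "rep mersenne (mersenne j) = 1 # replicate j 0"
    by (rule rep_mersenne_eqI) (simp_all add: word_value_replicate_0)
  then show ?thesis by (simp add: two_indicator_def)
qed

lemma two_indicator_in_run:
  assumes "1 \<le> t" "t \<le> j"
  shows "two_indicator (mersenne j - t) = 1"
proof -
  \<comment> \<open>The representation consists of \<open>t - 1\<close> ones, a 2 and
    \<open>j - t\<close> zeros: \<open>v\<close> falls one short of the next weight, and each
    prepended 1 increases the deficit by one.\<close>
  define v where "v = 2 # replicate (j - t) (0::nat)"
  let ?w = "replicate (t - 1) 1 @ v"
  have len: "length v = Suc (j - t)" by (simp add: v_def)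
  have "word_value mersenne v + 1 = mersenne (length v)"
    by (simp add: v_def word_value_replicate_0 mersenne_Suc)
  moreover have "length v + (t - 1) = j"
    using assms len by simp
  ultimately have "word_value mersenne ?w = mersenne j - t"
    using word_value_replicate_1_append[of "t - 1" v] assms by simp
  moreover have "hd ?w \<noteq> 0"
    by (cases "t - 1") (simp_all add: v_def)
  moreover have "?w \<noteq> []" "admissible ?w"
    unfolding admissible_replicate_1_append by (auto simp: v_def)
  ultimately have "rep mersenne (mersenne j - t) = ?w"
    by (intro rep_mersenne_eqI)
  then show ?thesis by (simp add: two_indicator_def v_def)
qed

text \<open>The word of \<open>j\<close> ones contains no 2 and falls short of
  \<open>mersenne j\<close> by \<open>j + 1\<close>; this bounds the run on the left.\<close>

lemma two_indicator_before_run: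
  assumes "1 \<le> j"
  shows "two_indicator (mersenne j - Suc j) = 0"
proof -
  have "word_value mersenne (replicate j 1) = mersenne j - Suc j"
    using word_value_replicate_1_append[of j "[]"] by simp
  then have "rep mersenne (mersenne j - Suc j) = replicate j 1"
    using assms admissible_replicate_1_append[of j "[]"]
    by (intro rep_mersenne_eqI) simp_all
  then show ?thesis by (simp add: two_indicator_def)
qed

text \<open>The window of length \<open>n\<close> in which the run of \<open>j\<close> ones starts at offset \<open>i\<close>.\<close>

definition run_window :: "nat \<Rightarrow> nat \<Rightarrow> nat \<Rightarrow> nat list" where
  "run_window n i j = map two_indicator [mersenne j - j - i..<mersenne j - j - i + n]"

text \<open>\<open>1 \<le> i\<close> and \<open>i + j < n\<close> keep both zeros bounding the run
  inside the window; \<open>i \<le> j\<close> and \<open>2 * j < mersenne j\<close> make the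
  subtractions exact.\<close>

lemma run_window_nth:
  assumes "1 \<le> i" "i \<le> j" "i + j < n"
  shows "run_window n i j ! (i - 1) = 0" "run_window n i j ! (i + j) = 0"
    and "\<And>k. i \<le> k \<Longrightarrow> k < i + j \<Longrightarrow> run_window n i j ! k = 1"
proof -
  have j: "2 * j < mersenne j" by (rule two_mult_less_mersenne)
  have nth: "run_window n i j ! k = two_indicator (mersenne j - j - i + k)" if "k < n" for k
    using that by (simp add: run_window_def)
  have "mersenne j - j - i + (i - 1) = mersenne j - Suc j"
    using assms j by simp
  then show "run_window n i j ! (i - 1) = 0"
    using nth[of "i - 1"] assms by (simp add: two_indicator_before_run)
  have "mersenne j - j - i + (i + j) = mersenne j"
    using assms j by simp
  then show "run_window n i j ! (i + j) = 0"
    using nth[of "i + j"] assms by (simp add: two_indicator_mersenne)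
  fix k assume k: "i \<le> k" "k < i + j"
  then have "mersenne j - j - i + k = mersenne j - (i + j - k)"
    using assms j by simp
  then show "run_window n i j ! k = 1"
    using nth[of k] two_indicator_in_run[of "i + j - k" j] assms k by simp
qed

text \<open>
  Two runs longer than half the window overlap, so being maximal they coincide.
\<close>

lemma run_window_inj:
  assumes "1 \<le> i" "i \<le> j" "i + j < n" "n < 2 * j"
    and "1 \<le> i'" "i' \<le> j'" "i' + j' < n" "n < 2 * j'"
    and eq: "run_window n i j = run_window n i' j'"
  shows "i = i' \<and> j = j'"
proof -
  note r = run_window_nth[OF assms(1-3), unfolded eq] and r' = run_window_nth[OF assms(5-7)]
  have "i = i'"
  proof (rule ccontr)
    assume "i \<noteq> i'"
    then consider "i < i'" | "i' < i" by linarith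
    then show False
    proof cases
      \<comment> \<open>Here \<open>i' < n - j' < n / 2 < j\<close>, so the zero just before the
        second run would lie inside the first.\<close>
      case 1
      then show False
        using r(3)[of "i' - 1"] r'(1) assms by simp
    next
      case 2
      then show False
        using r'(3)[of "i - 1"] r(1) assms by simp
    qed
  qed
  moreover have "j = j'"
  proof (rule ccontr)
    assume "j \<noteq> j'"
    then consider "j < j'" | "j' < j" by linarith
    then show False
    proof cases
      \<comment> \<open>With a common start, the zero ending the shorter run would lie inside the
        longer one.\<close>
      case 1
      then show False
        using r'(3)[of "i + j"] r(2) \<open>i = i'\<close> by simp
    next
      case 2
      then show False
        using r(3)[of "i' + j'"] r'(2) \<open>i = i'\<close> by simp
    qed
  qed
  ultimately show ?thesis by blast
qed

section \<open>Quadratic lower bound on the factor complexity\<close>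

lemma finite_factors:
  assumes "finite (range x)"
  shows "finite (factors x n)"
proof (rule finite_subset)
  show "factors x n \<subseteq> {w. set w \<subseteq> range x \<and> length w = n}"
    by (auto simp: factors_def)
  show "finite {w. set w \<subseteq> range x \<and> length w = n}"
    using assms by (rule finite_lists_length_eq)
qed

lemma factor_complexity_two_indicator_ge:
  "(n div 8)\<^sup>2 \<le> factor_complexity two_indicator n"
proof -
  \<comment> \<open>Offsets up to \<open>n / 8\<close> and run lengths from
    \<open>n div 2 + 1\<close> to \<open>n div 2 + m\<close> end each run by
    \<open>3 * n / 4\<close>, inside the window, with \<open>n < 2 * j\<close>.\<close>
  define m where "m = n div 8"
  let ?f = "\<lambda>(a, b). run_window n (Suc a) (n div 2 + Suc b)"
  have "inj_on ?f ({..<m} \<times> {..<m})"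
  proof (rule inj_onI, clarsimp)
    fix a b a' b'
    assume "a < m" "b < m" "a' < m" "b' < m"
      and "run_window n (Suc a) (Suc (n div 2 + b)) = run_window n (Suc a') (Suc (n div 2 + b'))"
    then show "a = a' \<and> b = b'"
      using run_window_inj[of "Suc a" "Suc (n div 2 + b)" n "Suc a'" "Suc (n div 2 + b')"]
      unfolding m_def by simp
  qed
  moreover have "?f ` ({..<m} \<times> {..<m}) \<subseteq> factors two_indicator n"
    by (auto simp: factors_def run_window_def)
  moreover have "finite (factors two_indicator n)"
  proof (rule finite_factors, rule finite_subset)
    show "range two_indicator \<subseteq> {0, 1}"
      by (auto simp: two_indicator_def)
  qed simp
  ultimately have "card ({..<m} \<times> {..<m}) \<le> card (factors two_indicator n)"
    by (rule card_inj_on_le)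
  then show ?thesis
    by (simp add: factor_complexity_def m_def power2_eq_square)
qed

lemma superlinear_complexity_two_indicator:
  "filterlim (\<lambda>n. real (factor_complexity two_indicator n) / real n) at_top sequentially"
proof (rule filterlim_at_top_mono)
  \<comment> \<open>Since \<open>n div 8 \<ge> (n - 8) / 8\<close>, the quotient is at least
    \<open>(n - 8)^2 / (64 * n)\<close>, which is \<open>n / 64 - 1 / 4 + 1 / n\<close>.\<close>
  show "filterlim (\<lambda>n. real n * (1 / 64) - 1 / 4) at_top sequentially"
    by real_asymp
  show "eventually (\<lambda>n. real n * (1 / 64) - 1 / 4 \<le> real (factor_complexity two_indicator n) / real n)
    sequentially"
  proof (rule eventually_sequentiallyI[of 8])
    fix n :: nat
    assume n: "8 \<le> n"
    have "n \<le> 8 * (n div 8) + 8" by simp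
    then have "real n \<le> 8 * real (n div 8) + 8"
      by linarith
    then have "(real n - 8)\<^sup>2 \<le> (8 * real (n div 8))\<^sup>2"
      using n by (intro power_mono) simp_all
    also have "\<dots> = 64 * real ((n div 8)\<^sup>2)"
      by (simp add: power_mult_distrib)
    also have "\<dots> \<le> 64 * real (factor_complexity two_indicator n)"
      using factor_complexity_two_indicator_ge[of n] by (simp del: of_nat_power)
    finally have "(real n * (1 / 64) - 1 / 4) * real n \<le> real (factor_complexity two_indicator n)"
      by (simp add: power2_eq_square algebra_simps)
    with n show "real n * (1 / 64) - 1 / 4 \<le> real (factor_complexity two_indicator n) / real n"
      by (simp add: pos_le_divide_eq)
  qed
qed

theorem theorem3p3:
  shows "\<exists>(U :: nat \<Rightarrow> nat) (B :: nat set) (x :: nat \<Rightarrow> nat).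
    bertrand U \<and> finite B \<and> range x \<subseteq> B \<and> automatic U B x \<and>
    filterlim (\<lambda>n. real (factor_complexity x n) / real n) at_top sequentially"
proof (intro exI conjI)
  show "bertrand mersenne" by (rule bertrand_mersenne)
  show "automatic mersenne {0, 1} two_indicator" by (rule automatic_two_indicator)
  show "range two_indicator \<subseteq> {0, 1}" by (auto simp: two_indicator_def)
qed (simp_all add: superlinear_complexity_two_indicator)

end
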